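(* Let $p\ge 2$ and $n\ge\max\{4,2p-1\}$. Let $F\subseteq E(K_n)$ be a set of $p$ edges, and assume that $K_n-F$ is connected. Let $F_0\subseteq E(K_n)$ be an edge set such that $H_{F_0}\cong P_3\cup(p-2)K_2$. If $H_F$ is not a matching, then $$Kf(K_n-F)\ge Kf(K_n-F_0),$$ and more explicitly $$Kf(K_n-F)\ge n-1+\frac{3}{n-3}+\frac{1}{n-1}+\frac{2(p-2)}{n-2}.$$ Equality holds if and only if $H_F\cong P_3\cup(p-2)K_2$.
   Context: $K_n$ is the complete graph on $n$ vertices and $K_n-F$ is obtained from it by deleting the edges in $F$ (keeping all vertices). The deletion graph of $F$ is $H_F=(V(F),F)$ with $V(F)=\bigcup_{e\in F}e$ (the set of endpoints of edges of $F$). $P_3$ is the path on $3$ vertices, and $P_3\cup(p-2)K_2$ is the disjoint union of $P_3$ and $p-2$ single edges. "$H_F$ is not a matching" means that some two distinct edges of $F$ share an endpoint, i.e. $H_F\not\cong pK_2$. For a connected graph $G$ with Laplacian $L(G)=D(G)-A(G)$, the effective resistance between distinct vertices is $R_G(x,y)=(e_x-e_y)^TL(G)^+(e_x-e_y)$ ($L(G)^+$ the Moore--Penrose inverse, $e_x$ the standard basis vector of vertex $x$), and the Kirchhoff index is $Kf(G)=\sum_{\{x,y\}}R_G(x,y)$, the sum over all unordered pairs of distinct vertices. *)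

theory Defs
  imports "HOL-Analysis.Analysis"
begin

section \<open>Finite simple graphs\<close>

text \<open>Edges are two-element sets of vertices.\<close>

record 'a sgraph =
  verts :: "'a set"
  edges :: "'a set set"

definition complete_graph :: "'a set \<Rightarrow> 'a sgraph" where
  "complete_graph V = \<lparr>verts = V, edges = {e. e \<subseteq> V \<and> card e = 2}\<rparr>"

definition path_graph :: "nat \<Rightarrow> nat sgraph" where
  "path_graph k = \<lparr>verts = {..<k}, edges = {{i, Suc i} |i. Suc i < k}\<rparr>"

definition disjoint_union :: "'a sgraph \<Rightarrow> 'b sgraph \<Rightarrow> ('a + 'b) sgraph" where
  "disjoint_union G H =
     \<lparr>verts = verts G <+> verts H,
      edges = (\<lambda>e. Inl ` e) ` edges G \<union> (\<lambda>e. Inr ` e) ` edges H\<rparr>"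

definition copies :: "nat \<Rightarrow> 'a sgraph \<Rightarrow> (nat \<times> 'a) sgraph" where
  "copies m G =
     \<lparr>verts = {..<m} \<times> verts G, edges = {Pair i ` e |i e. i < m \<and> e \<in> edges G}\<rparr>"

definition delete_edges :: "'a sgraph \<Rightarrow> 'a set set \<Rightarrow> 'a sgraph" where
  "delete_edges G F = \<lparr>verts = verts G, edges = edges G - F\<rparr>"

definition deletion_graph :: "'a set set \<Rightarrow> 'a sgraph" where
  "deletion_graph F = \<lparr>verts = \<Union>F, edges = F\<rparr>"

definition graph_iso :: "'a sgraph \<Rightarrow> 'b sgraph \<Rightarrow> bool" where
  "graph_iso G H \<longleftrightarrow>
     (\<exists>f. bij_betw f (verts G) (verts H) \<and>
          (\<forall>x\<in>verts G. \<forall>y\<in>verts G. {x, y} \<in> edges G \<longleftrightarrow> {f x, f y} \<in> edges H))"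

definition is_matching :: "'a sgraph \<Rightarrow> bool" where
  "is_matching G \<longleftrightarrow> (\<forall>e\<in>edges G. \<forall>e'\<in>edges G. e \<noteq> e' \<longrightarrow> e \<inter> e' = {})"

definition graph_connected :: "'a sgraph \<Rightarrow> bool" where
  "graph_connected G \<longleftrightarrow>
     verts G \<noteq> {} \<and> (\<forall>x\<in>verts G. \<forall>y\<in>verts G. (x, y) \<in> {(u, v). {u, v} \<in> edges G}\<^sup>*)"

text \<open>The graph consisting of a path on three vertices and \<open>p - 2\<close> single edges, all disjoint
  (the truncated subtraction is intended for \<open>p \<ge> 2\<close> only).\<close>

definition P3_plus_edges :: "nat \<Rightarrow> (nat + nat \<times> nat) sgraph" where
  "P3_plus_edges p =
     disjoint_union (path_graph 3) (copies (p - 2) (complete_graph {..<2::nat}))"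

section \<open>The Moore-Penrose inverse of a real matrix\<close>

definition is_moore_penrose :: "real^'n^'m \<Rightarrow> real^'m^'n \<Rightarrow> bool" where
  "is_moore_penrose A X \<longleftrightarrow>
     A ** X ** A = A \<and> X ** A ** X = X \<and>
     transpose (A ** X) = A ** X \<and> transpose (X ** A) = X ** A"

lemma is_moore_penrose_unique:
  assumes X: "is_moore_penrose A X" and Y: "is_moore_penrose A Y"
  shows "X = Y"
proof -
  have x: "A ** X ** A = A" "X ** A ** X = X" "transpose (A ** X) = A ** X"
      "transpose (X ** A) = X ** A"
    and y: "A ** Y ** A = A" "Y ** A ** Y = Y" "transpose (A ** Y) = A ** Y"
      "transpose (Y ** A) = Y ** A"
    using X Y by (auto simp: is_moore_penrose_def)
  have "A ** X = (A ** Y) ** (A ** X)"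
    using y(1) by (simp add: matrix_mul_assoc)
  also have "\<dots> = transpose ((A ** X) ** (A ** Y))"
    by (simp only: matrix_transpose_mul[of "A ** X" "A ** Y"] x(3) y(3))
  also have "(A ** X) ** (A ** Y) = A ** Y"
    using x(1) by (simp add: matrix_mul_assoc)
  finally have 1: "A ** X = A ** Y" using y(3) by simp
  have "X ** A = (X ** A) ** (Y ** A)"
    using y(1) by (metis matrix_mul_assoc)
  also have "\<dots> = transpose ((Y ** A) ** (X ** A))"
    by (simp only: matrix_transpose_mul[of "Y ** A" "X ** A"] x(4) y(4))
  also have "(Y ** A) ** (X ** A) = Y ** A"
    using x(1) by (metis matrix_mul_assoc)
  finally have 2: "X ** A = Y ** A" using y(4) by simp
  have "X = X ** (A ** X)" using x(2) by (simp add: matrix_mul_assoc)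
  also have "\<dots> = Y ** A ** Y" using 1 2 by (metis matrix_mul_assoc)
  finally show ?thesis using y(2) by simp
qed

definition moore_penrose :: "real^'n^'m \<Rightarrow> real^'m^'n" where
  "moore_penrose A = (THE X. is_moore_penrose A X)"

section \<open>Effective resistance and the Kirchhoff index\<close>

text \<open>Matrices are indexed by the whole vertex type. Elements of the type outside \<open>verts G\<close>
  contribute only zero rows and columns to the Laplacian.\<close>

definition degree_matrix :: "'v::finite sgraph \<Rightarrow> real^'v^'v" where
  "degree_matrix G = (\<chi> i j. if i = j then real (card {e \<in> edges G. i \<in> e}) else 0)"

definition adjacency_matrix :: "'v::finite sgraph \<Rightarrow> real^'v^'v" where
  "adjacency_matrix G = (\<chi> i j. if {i, j} \<in> edges G then 1 else 0)"

definition laplacian :: "'v::finite sgraph \<Rightarrow> real^'v^'v" where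
  "laplacian G = degree_matrix G - adjacency_matrix G"

definition eff_resistance :: "'v::finite sgraph \<Rightarrow> 'v \<Rightarrow> 'v \<Rightarrow> real" where
  "eff_resistance G x y =
     (axis x 1 - axis y 1) \<bullet> (moore_penrose (laplacian G) *v (axis x 1 - axis y 1))"

lemma eff_resistance_sym: "eff_resistance G x y = eff_resistance G y x"
proof -
  have "axis x 1 - axis y 1 = - (axis y 1 - axis x 1 :: real^'a)" by simp
  then show ?thesis
    unfolding eff_resistance_def
    by (metis (no_types) inner_minus_left inner_minus_right minus_minus
        matrix_vector_mult_scaleR scaleR_minus1_left)
qed

text \<open>By symmetry of the resistance, summing over ordered pairs counts every unordered pair
  twice.\<close>

definition kirchhoff_index :: "'v::finite sgraph \<Rightarrow> real" where
  "kirchhoff_index G = (\<Sum>x\<in>verts G. \<Sum>y\<in>verts G - {x}. eff_resistance G x y) / 2"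

end

theory Submission
  imports Defs
begin

text \<open>Let \<open>M\<^sub>F = n I - \<Sum> b\<^sub>e b\<^sub>e\<^sup>T\<close>, the sum running over \<open>e \<in> F\<close>, with \<open>b\<^sub>e\<close> the difference of the basis
  vectors of the endpoints of \<open>e\<close>. Then \<open>L(K\<^sub>n - F) = M\<^sub>F - J\<close> with \<open>J\<close> the all-ones matrix, so
  the Moore-Penrose inverse is \<open>M\<^sub>F\<close>-inverse minus \<open>J / n\<^sup>2\<close> and the Kirchhoff index is \<open>n\<close> times
  the trace of \<open>M\<^sub>F\<close>-inverse, minus \<open>1\<close>.

  Start with two edges of \<open>F\<close> that share an endpoint, where the trace is explicit, and add the
  other edges one at a time. By the Sherman-Morrison formula the edge \<open>e\<close> increases the trace by
  \<open>(v \<bullet> v) / (1 - s)\<close>, where \<open>v\<close> solves \<open>M v = b\<^sub>e\<close> and \<open>s = b\<^sub>e \<bullet> v\<close>. Since \<open>M \<le> n I\<close> we have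
  \<open>s \<ge> 2 / n\<close>, and \<open>v \<bullet> v \<ge> s\<^sup>2 / 2\<close> by Cauchy-Schwarz, so the increase is at least
  \<open>2 / (n (n - 2))\<close>, with equality exactly if \<open>e\<close> is disjoint from the edges added before.\<close>

section \<open>Rank-one downdates of positive definite matrices\<close>

definition outer :: "real^'n \<Rightarrow> real^'n^'n" where
  "outer u = (\<chi> i j. u $ i * u $ j)"

lemma outer_mult_vec: "outer u *v z = (u \<bullet> z) *\<^sub>R u"
  by (simp add: vec_eq_iff outer_def matrix_vector_mult_def inner_vec_def sum_distrib_left mult_ac)

lemma trace_outer: "trace (outer u) = u \<bullet> u"
  by (simp add: trace_def outer_def inner_vec_def)

lemma inner_symmetric_mult_vec:
  fixes A :: "real^'n^'n"
  assumes "transpose A = A"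
  shows "x \<bullet> (A *v y) = (A *v x) \<bullet> y"
  by (metis assms dot_lmul_matrix vector_transpose_matrix inner_commute transpose_matrix_vector)

section \<open>Elementary algebra of traces, transposes and matrix products\<close>

lemma trace_scaleR: "trace (c *\<^sub>R (A :: real^'n^'n)) = c * trace A"
  by (simp add: trace_def sum_distrib_left)

lemma transpose_add: "transpose (A + B) = transpose A + transpose (B :: 'a::semiring_1^'n^'m)"
  by (simp add: vec_eq_iff transpose_def)

lemma transpose_diff: "transpose (A - B) = transpose A - transpose (B :: 'a::ring_1^'n^'m)"
  by (simp add: vec_eq_iff transpose_def)

lemma transpose_zero: "transpose (0 :: 'a::zero^'n^'m) = 0"
  by (simp add: vec_eq_iff transpose_def)

lemma matrix_diff_ldistrib: "A ** (B - C) = A ** B - A ** (C :: 'a::ring_1^'p^'n)"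
  by (simp add: vec_eq_iff matrix_matrix_mult_def right_diff_distrib sum_subtractf)

lemma matrix_diff_rdistrib: "(A - B) ** C = A ** C - B ** (C :: 'a::ring_1^'p^'n)"
  by (simp add: vec_eq_iff matrix_matrix_mult_def left_diff_distrib sum_subtractf)

lemma matrix_scaleR_left: "(c *\<^sub>R A) ** B = c *\<^sub>R (A ** (B :: 'a::real_algebra_1^'p^'n))"
  by (simp add: scalar_matrix_assoc)

lemma matrix_scaleR_right: "A ** (c *\<^sub>R B) = c *\<^sub>R (A ** (B :: 'a::real_algebra_1^'p^'n))"
  by (simp add: scalar_matrix_assoc matrix_scalar_ac)

lemma transpose_sum:
  "transpose (sum A I) = (\<Sum>i\<in>I. transpose (A i :: 'a::semiring_1^'n^'m))"
  by (induction I rule: infinite_finite_induct) (simp_all add: transpose_add transpose_zero)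

lemma sum_matrix_vector_mult:
  "sum A I *v x = (\<Sum>i\<in>I. A i *v (x :: 'a::semiring_1^'n))"
  by (induction I rule: infinite_finite_induct) (simp_all add: matrix_vector_mult_add_rdistrib)

text \<open>Only the quadratic form is constrained; symmetry is carried separately as
  \<open>transpose A = A\<close>.\<close>

definition pos_def :: "real^'n^'n \<Rightarrow> bool" where
  "pos_def A \<longleftrightarrow> (\<forall>x. x \<noteq> 0 \<longrightarrow> x \<bullet> (A *v x) > 0)"

lemma matrix_inv_mult:
  assumes "invertible A"
  shows "matrix_inv A ** A = mat 1" "A ** matrix_inv A = mat 1"
  using someI_ex[OF assms[unfolded invertible_def]] by (auto simp: matrix_inv_def)

text \<open>For square matrices a right inverse is two-sided, so checking one product identifies the
  inverse.\<close>

lemma matrix_inv_eqI: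
  fixes A :: "real^'n^'n"
  assumes "A ** X = mat 1"
  shows "matrix_inv A = X"
proof -
  have "invertible A" using assms by (auto simp: invertible_right_inverse)
  then have "matrix_inv A ** (A ** X) = X"
    by (simp add: matrix_mul_assoc matrix_inv_mult)
  then show ?thesis by (simp add: assms)
qed

text \<open>The quadratic form vanishes at a kernel vector, so the kernel is trivial.\<close>

lemma pos_def_invertible:
  fixes A :: "real^'n^'n"
  assumes "pos_def A"
  shows "A ** matrix_inv A = mat 1" "matrix_inv A ** A = mat 1"
proof -
  have "x = 0" if "A *v x = 0" for x
    using assms that by (force simp: pos_def_def)
  then have "invertible A"
    by (simp add: invertible_left_inverse matrix_left_invertible_ker)
  then show "A ** matrix_inv A = mat 1" "matrix_inv A ** A = mat 1"
    by (auto simp: matrix_inv_mult)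
qed

lemma transpose_matrix_inv:
  fixes A :: "real^'n^'n"
  assumes "pos_def A" "transpose A = A"
  shows "transpose (matrix_inv A) = matrix_inv A"
proof -
  have "A ** transpose (matrix_inv A) = mat 1"
    by (metis assms matrix_transpose_mul pos_def_invertible(2) transpose_mat)
  then show ?thesis using matrix_inv_eqI by metis
qed

text \<open>Sherman-Morrison formula. The product with the proposed inverse is applied to an
  arbitrary \<open>z\<close>; everything besides \<open>z\<close> is a multiple of \<open>b\<close>
  and cancels.\<close>

lemma matrix_inv_minus_outer:
  fixes A :: "real^'n^'n"
  assumes "pos_def A" and sym: "transpose A = A" and s: "b \<bullet> (matrix_inv A *v b) \<noteq> 1"
  shows "matrix_inv (A - outer b) =
    matrix_inv A + (1 / (1 - b \<bullet> (matrix_inv A *v b))) *\<^sub>R outer (matrix_inv A *v b)"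
proof (rule matrix_inv_eqI)
  define X where "X = matrix_inv A"
  define v where "v = X *v b"
  define c where "c = 1 / (1 - b \<bullet> v)"
  have AX: "A *v (X *v z) = z" for z
    using pos_def_invertible(1)[OF assms(1)] by (simp add: X_def matrix_vector_mul_assoc)
  have v: "v \<bullet> z = b \<bullet> (X *v z)" for z
    by (simp add: v_def X_def inner_symmetric_mult_vec transpose_matrix_inv assms(1) sym)
  \<comment> \<open>This form of the choice of \<open>c\<close> is what makes the coefficient of
    \<open>b\<close> vanish below.\<close>
  have c: "c = 1 + c * (b \<bullet> v)"
    using s by (simp add: c_def v_def X_def divide_simps)
  have "(A - outer b) *v ((X + c *\<^sub>R outer v) *v z) = z" for z
  proof -
    have "(A - outer b) *v ((X + c *\<^sub>R outer v) *v z)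
        = z + (c * (v \<bullet> z)) *\<^sub>R b - (b \<bullet> (X *v z) + c * (v \<bullet> z) * (b \<bullet> v)) *\<^sub>R b"
      using AX[of b] by (simp add: matrix_vector_mult_diff_rdistrib matrix_vector_mult_add_rdistrib
          outer_mult_vec AX scaleR_matrix_vector_assoc[symmetric]
          matrix_vector_right_distrib inner_add_right matrix_vector_mult_scaleR algebra_simps flip: v_def)
    also have "\<dots> = z + ((c - (1 + c * (b \<bullet> v))) * (v \<bullet> z)) *\<^sub>R b"
      by (simp add: v algebra_simps)
    also have "\<dots> = z" using c by simp
    finally show ?thesis .
  qed
  then have "(A - outer b) ** (X + c *\<^sub>R outer v) = mat 1"
    by (simp add: matrix_eq flip: matrix_vector_mul_assoc)
  then show "(A - outer b) ** (matrix_inv A + (1 / (1 - b \<bullet> (matrix_inv A *v b))) *\<^sub>R outer (matrix_inv A *v b)) = mat 1"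
    by (simp add: X_def c_def v_def)
qed

section \<open>Change of the trace of the inverse when \<open>outer b\<close> is subtracted\<close>

context
  fixes A :: "real^'n^'n" and b :: "real^'n"
  assumes pd: "pos_def (A - outer b)" and sym: "transpose A = A"
begin

text \<open>Subtracting \<open>outer b\<close> only lowers the quadratic form. Positive definiteness
  thus passes from a set of deleted edges to its subsets, which is why the context assumes it for
  the smaller matrix.\<close>

lemma pos_def_add_outer: "pos_def A"
  unfolding pos_def_def
proof (intro allI impI)
  fix x :: "real^'n" assume "x \<noteq> 0"
  then have "0 < x \<bullet> ((A - outer b) *v x)" using pd by (simp add: pos_def_def)
  also have "\<dots> = x \<bullet> (A *v x) - (b \<bullet> x)\<^sup>2"
    by (simp add: matrix_vector_mult_diff_rdistrib outer_mult_vec inner_diff_right power2_eq_square inner_commute)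
  also have "\<dots> \<le> x \<bullet> (A *v x)" by simp
  finally show "0 < x \<bullet> (A *v x)" .
qed

text \<open>For nonzero \<open>b\<close> and \<open>v\<close> solving \<open>A *v v = b\<close>, the
  forms of \<open>A\<close> and \<open>A - outer b\<close> at \<open>v\<close> are
  \<open>b \<bullet> v\<close> and \<open>(b \<bullet> v) * (1 - b \<bullet> v)\<close>. Both are
  positive, so the Sherman-Morrison denominator is positive.\<close>

lemma inner_inv_less_1: "b \<bullet> (matrix_inv A *v b) < 1"
proof (cases "b = 0")
  case False
  define v where "v = matrix_inv A *v b"
  have Av: "A *v v = b"
    using pos_def_invertible(1)[OF pos_def_add_outer] by (simp add: v_def matrix_vector_mul_assoc)
  with False have "v \<noteq> 0" by auto
  then have "0 < v \<bullet> (A *v v)" "0 < v \<bullet> ((A - outer b) *v v)"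
    using pd pos_def_add_outer by (auto simp: pos_def_def)
  then have "0 < b \<bullet> v" "0 < (b \<bullet> v) * (1 - b \<bullet> v)"
    using Av by (simp_all add: matrix_vector_mult_diff_rdistrib outer_mult_vec inner_diff_right
        inner_commute algebra_simps)
  then show ?thesis by (simp add: zero_less_mult_iff v_def)
qed simp

lemma trace_inv_minus_outer:
  "trace (matrix_inv (A - outer b)) = trace (matrix_inv A)
    + (matrix_inv A *v b) \<bullet> (matrix_inv A *v b) / (1 - b \<bullet> (matrix_inv A *v b))"
proof -
  have "b \<bullet> (matrix_inv A *v b) \<noteq> 1" using inner_inv_less_1 by simp
  then show ?thesis
    by (simp add: matrix_inv_minus_outer[OF pos_def_add_outer sym] trace_add trace_scaleR trace_outer)
qed

context
  fixes c :: real
  assumes c: "c > 0" and le: "\<And>x. x \<bullet> (A *v x) \<le> c * (x \<bullet> x)" and b: "b \<noteq> 0"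
begin

text \<open>The right-hand side is \<open>(b \<bullet> b) / c\<close> plus the defect
  \<open>c * (b \<bullet> b) - b \<bullet> (A *v b)\<close> divided by \<open>c\<^sup>2\<close>.
  Keeping the defect lets strictness be read off later.\<close>

lemma inner_inv_ge:
  "b \<bullet> (matrix_inv A *v b) \<ge> 2 * (b \<bullet> b) / c - b \<bullet> (A *v b) / c\<^sup>2"
proof -
  define v where "v = matrix_inv A *v b"
  define w where "w = v - (1 / c) *\<^sub>R b"
  have Av: "A *v v = b"
    using pos_def_invertible(1)[OF pos_def_add_outer] by (simp add: v_def matrix_vector_mul_assoc)
  \<comment> \<open>If \<open>A\<close> were \<open>c I\<close> then \<open>v = b / c\<close>; the form of \<open>A\<close> at the deviation \<open>w\<close> gives the bound.\<close>
  have "0 \<le> w \<bullet> (A *v w)"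
    using pos_def_add_outer by (cases "w = 0") (auto simp: pos_def_def less_imp_le)
  also have "A *v w = b - (1 / c) *\<^sub>R (A *v b)"
    by (simp add: w_def matrix_vector_mult_diff_distrib matrix_vector_mult_scaleR Av)
  also have "w \<bullet> \<dots> = b \<bullet> v - (b \<bullet> b) / c - (v \<bullet> (A *v b)) / c + b \<bullet> (A *v b) / c\<^sup>2"
    by (simp add: w_def inner_diff_left inner_diff_right power2_eq_square inner_commute diff_divide_distrib)
  also have "v \<bullet> (A *v b) = b \<bullet> b"
    using inner_symmetric_mult_vec[OF sym, of v b] Av by simp
  finally show ?thesis by (simp add: v_def)
qed

text \<open>Cauchy-Schwarz bounds \<open>v \<bullet> v\<close> below by
  \<open>(b \<bullet> v)\<^sup>2 / (b \<bullet> b)\<close>. Lowering \<open>b \<bullet> v\<close> to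
  \<open>t\<close> then shrinks the numerator and enlarges the denominator of the exact
  increment.\<close>

lemma trace_inv_increment_ge_of_inner_ge:
  assumes s: "b \<bullet> (matrix_inv A *v b) \<ge> t" and t: "t > 0"
  shows "trace (matrix_inv (A - outer b)) \<ge> trace (matrix_inv A) + t\<^sup>2 / ((b \<bullet> b) * (1 - t))"
proof -
  define v where "v = matrix_inv A *v b"
  have "(b \<bullet> v)\<^sup>2 \<le> (b \<bullet> b) * (v \<bullet> v)"
    by (rule Cauchy_Schwarz_ineq)
  moreover have "t\<^sup>2 \<le> (b \<bullet> v)\<^sup>2"
    using s t by (simp add: v_def power_mono)
  moreover have bb: "b \<bullet> b > 0" using b by simp
  ultimately have "t\<^sup>2 / (b \<bullet> b) \<le> v \<bullet> v"
    by (simp add: divide_le_eq mult.commute)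
  then have "t\<^sup>2 / (b \<bullet> b) / (1 - t) \<le> v \<bullet> v / (1 - b \<bullet> v)"
    using s inner_inv_less_1 by (intro frac_le) (auto simp: v_def)
  then show ?thesis by (simp add: trace_inv_minus_outer v_def)
qed

text \<open>The increment is at least \<open>g s\<close>, where \<open>g\<close> is strictly
  increasing between 0 and 1 and \<open>g (\<beta> / c)\<close> is the stated amount. A positive
  defect pushes \<open>s\<close> strictly above \<open>\<beta> / c\<close>, hence the strict
  version.\<close>

lemma trace_inv_increment_ge:
  "trace (matrix_inv (A - outer b)) \<ge> trace (matrix_inv A) + (b \<bullet> b) / (c * (c - b \<bullet> b))"
  (is ?ge)
and trace_inv_increment_gt:
  "b \<bullet> (A *v b) < c * (b \<bullet> b) \<Longrightarrow>
    trace (matrix_inv (A - outer b)) > trace (matrix_inv A) + (b \<bullet> b) / (c * (c - b \<bullet> b))"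
  (is "_ \<Longrightarrow> ?gt")
proof -
  define \<beta> where "\<beta> = b \<bullet> b"
  define s where "s = b \<bullet> (matrix_inv A *v b)"
  define g where "g t = t\<^sup>2 / (\<beta> * (1 - t))" for t
  have \<beta>: "\<beta> > 0" using b by (simp add: \<beta>_def)
  have s1: "s < 1" using inner_inv_less_1 by (simp add: s_def)
  have s: "s \<ge> \<beta> / c + (c * \<beta> - b \<bullet> (A *v b)) / c\<^sup>2"
    using inner_inv_ge c by (simp add: s_def \<beta>_def field_simps power2_eq_square)
  have s0: "\<beta> / c \<le> s"
    using s le[of b] c by (smt (verit) \<beta>_def divide_nonneg_nonneg zero_le_power2)
  \<comment> \<open>Positivity of the denominator \<open>c - b \<bullet> b\<close> is a consequence
    of \<open>\<beta> / c \<le> s\<close> and \<open>s < 1\<close>.\<close>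
  have \<beta>c: "\<beta> < c" using s0 s1 c by (meson divide_less_eq_1_pos le_less_trans)
  have gc: "g (\<beta> / c) = \<beta> / (c * (c - \<beta>))"
    using \<beta> c \<beta>c by (simp add: g_def field_simps power2_eq_square)
  have tr: "trace (matrix_inv (A - outer b)) \<ge> trace (matrix_inv A) + g s"
    using trace_inv_increment_ge_of_inner_ge[of s] s0 \<beta> c by (simp add: g_def s_def \<beta>_def less_le_trans[OF _ s0[unfolded s_def \<beta>_def]])
  have g_mono: "g t < g u" if "0 < t" "t < u" "u < 1" for t u
    unfolding g_def using that \<beta> by (intro frac_less) (auto intro!: power_strict_mono mult_strict_mono)
  show ?ge
  proof (cases "\<beta> / c = s")
    case False
    then show ?thesis using g_mono[of "\<beta> / c" s] s0 s1 tr gc \<beta> c by (auto simp: \<beta>_def)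
  qed (use tr gc in \<open>auto simp: \<beta>_def\<close>)
  assume "b \<bullet> (A *v b) < c * (b \<bullet> b)"
  then have "0 < (c * \<beta> - b \<bullet> (A *v b)) / c\<^sup>2" using c by (simp add: \<beta>_def)
  then have "\<beta> / c < s" using s by linarith
  then show ?gt using g_mono[of "\<beta> / c" s] s1 tr gc \<beta> c by (auto simp: \<beta>_def)
qed

end

text \<open>An eigenvector \<open>b\<close> satisfies
  \<open>matrix_inv A *v b = (1 / c) *\<^sub>R b\<close>, so the exact increment can be evaluated
  and attains the lower bound.\<close>

lemma trace_inv_increment_eq:
  assumes "A *v b = c *\<^sub>R b" "c > 0"
  shows "trace (matrix_inv (A - outer b)) = trace (matrix_inv A) + (b \<bullet> b) / (c * (c - b \<bullet> b))"
proof -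
  have "b = matrix_inv A *v (A *v b)"
    using pos_def_invertible(2)[OF pos_def_add_outer] by (simp add: matrix_vector_mul_assoc)
  then have "b = c *\<^sub>R (matrix_inv A *v b)"
    by (simp add: assms matrix_vector_mult_scaleR)
  then have "(1 / c) *\<^sub>R b = (1 / c) *\<^sub>R (c *\<^sub>R (matrix_inv A *v b))" by simp
  then have v: "matrix_inv A *v b = (1 / c) *\<^sub>R b"
    using assms(2) by simp
  have "b \<bullet> b < c" using inner_inv_less_1 assms(2) by (simp add: v)
  then show ?thesis using assms(2)
    by (simp add: trace_inv_minus_outer v field_simps)
qed

end

section \<open>Recognising a path on three vertices plus a matching\<close>

text \<open>Isomorphism-free description of the extremal deletion graph, in the shape that the
  equality case of the trace bound produces. The number of edges is tracked separately.\<close>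

definition P3_and_matching :: "'a set set \<Rightarrow> bool" where
  "P3_and_matching F \<longleftrightarrow> (\<exists>e\<in>F. \<exists>f\<in>F. e \<noteq> f \<and> e \<inter> f \<noteq> {} \<and>
     (\<forall>g\<in>F - {e, f}. \<forall>h\<in>F - {g}. g \<inter> h = {}))"

lemma inj_on_image_sets:
  assumes "inj_on h V" "\<And>e. e \<in> E \<Longrightarrow> e \<subseteq> V"
  shows "inj_on ((`) h) E"
proof (rule inj_onI)
  fix e f assume "e \<in> E" "f \<in> E" "h ` e = h ` f"
  then show "e = f" using inj_on_image_eq_iff[OF assms(1), of e f] assms(2) by blast
qed

text \<open>Injectivity on \<open>V\<close> makes images commute with intersections, so meeting
  pairs and disjoint pairs are both preserved.\<close>

lemma P3_and_matching_image:
  assumes h: "inj_on h V" and E: "\<And>e. e \<in> E \<Longrightarrow> e \<subseteq> V" and P: "P3_and_matching E"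
  shows "P3_and_matching ((`) h ` E)"
proof -
  have inj: "inj_on ((`) h) E" using inj_on_image_sets[OF h E] .
  obtain e f where ef: "e \<in> E" "f \<in> E" "e \<noteq> f" "e \<inter> f \<noteq> {}"
    and g: "\<forall>g\<in>E - {e, f}. \<forall>g'\<in>E - {g}. g \<inter> g' = {}"
    using P unfolding P3_and_matching_def by (elim bexE conjE)
  have disj: "h ` g \<inter> h ` g' = h ` (g \<inter> g')" if "g \<in> E" "g' \<in> E" for g g'
    using inj_on_image_Int[OF h, of g g'] E that by simp
  have "h ` g \<inter> h ` g' = {}"
    if "g \<in> E" "g' \<in> E" "h ` g \<noteq> h ` e" "h ` g \<noteq> h ` f" "h ` g' \<noteq> h ` g" for g g'
  proof -
    have "g \<in> E - {e, f}" "g' \<in> E - {g}" using that by auto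
    then have "g \<inter> g' = {}" using g by blast
    then show ?thesis using disj that by simp
  qed
  then have "\<forall>g\<in>(`) h ` E - {h ` e, h ` f}. \<forall>g'\<in>(`) h ` E - {g}. g \<inter> g' = {}"
    by blast
  moreover have "h ` e \<noteq> h ` f" using inj ef by (meson inj_on_eq_iff)
  moreover have "h ` e \<inter> h ` f \<noteq> {}" using ef by blast
  ultimately show ?thesis
    unfolding P3_and_matching_def
    by (intro bexI[of _ "h ` e"] bexI[of _ "h ` f"] conjI imageI ef(1,2))
qed

lemma edge_pairE:
  assumes "card e = 2" "card f = 2" "e \<noteq> f" "e \<inter> f \<noteq> {}"
  obtains x y z where "e = {x, y}" "f = {y, z}" "x \<noteq> y" "y \<noteq> z" "x \<noteq> z"
proof -
  obtain y where y: "y \<in> e" "y \<in> f" using assms(4) by blast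
  have other: "\<exists>a. g = {y, a} \<and> a \<noteq> y" if g: "y \<in> g" "card g = 2" for g
  proof -
    have "card (g - {y}) = 1" using g by simp
    then obtain a where "g - {y} = {a}" by (auto simp: card_1_singleton_iff)
    then show ?thesis using g(1) by (intro exI[of _ a]) blast
  qed
  obtain x where x: "e = {y, x}" "x \<noteq> y" using other[OF y(1) assms(1)] by blast
  obtain z where z: "f = {y, z}" "z \<noteq> y" using other[OF y(2) assms(2)] by blast
  have "x \<noteq> z" using assms(3) x z by auto
  then show thesis using that[of x y z] x z by (simp add: insert_commute)
qed

text \<open>The inverse of the isomorphism carries the edges of \<open>H\<close> onto those of
  \<open>G\<close>. As edges are two-element sets, \<open>graph_iso\<close>, which compares only
  sets \<open>{x, y}\<close>, sees all of them.\<close>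

lemma graph_iso_edge_image:
  assumes "graph_iso G H"
    and G: "\<And>e. e \<in> edges G \<Longrightarrow> e \<subseteq> verts G \<and> card e = 2"
    and H: "\<And>e. e \<in> edges H \<Longrightarrow> e \<subseteq> verts H \<and> card e = 2"
  obtains h where "bij_betw h (verts H) (verts G)" "edges G = (`) h ` edges H"
proof -
  obtain f where f: "bij_betw f (verts G) (verts H)"
    and e: "\<And>x y. x \<in> verts G \<Longrightarrow> y \<in> verts G \<Longrightarrow> {x, y} \<in> edges G \<longleftrightarrow> {f x, f y} \<in> edges H"
    using assms(1) unfolding graph_iso_def by blast
  define h where "h = inv_into (verts G) f"
  have h: "bij_betw h (verts H) (verts G)" unfolding h_def using f by (rule bij_betw_inv_into)
  have hf: "h (f x) = x" if "x \<in> verts G" for x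
    using that f by (simp add: h_def bij_betw_inv_into_left)
  have fh: "f (h x) = x" "h x \<in> verts G" if "x \<in> verts H" for x
    using that f h by (auto simp: h_def bij_betw_inv_into_right bij_betwE)
  have "E \<in> (`) h ` edges H" if EG: "E \<in> edges G" for E
  proof -
    obtain x y where E: "E = {x, y}" using G[OF EG] by (meson card_2_iff)
    have xy: "x \<in> verts G" "y \<in> verts G" using G[OF EG] E by auto
    then have "{f x, f y} \<in> edges H" using e[of x y] EG E by simp
    moreover have "E = h ` {f x, f y}" using hf xy E by simp
    ultimately show ?thesis by blast
  qed
  moreover have "h ` E \<in> edges G" if EH: "E \<in> edges H" for E
  proof -
    obtain x y where E: "E = {x, y}" using H[OF EH] by (meson card_2_iff)
    have xy: "x \<in> verts H" "y \<in> verts H" using H[OF EH] E by auto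
    then show ?thesis using e[of "h x" "h y"] EH E fh by simp
  qed
  ultimately have "edges G = (`) h ` edges H" by (intro equalityI subsetI) (simp, elim imageE, simp)
  then show thesis using that h by blast
qed

text \<open>The isomorphism is the inverse of \<open>h\<close>; injectivity of \<open>h\<close>
  recovers an edge from its image.\<close>

lemma graph_iso_of_edge_image:
  assumes h: "bij_betw h (verts H) (verts G)" and eq: "edges G = (`) h ` edges H"
    and H: "\<And>e. e \<in> edges H \<Longrightarrow> e \<subseteq> verts H"
  shows "graph_iso G H"
  unfolding graph_iso_def
proof (intro exI conjI ballI)
  let ?f = "inv_into (verts H) h"
  show f: "bij_betw ?f (verts G) (verts H)" using h by (rule bij_betw_inv_into)
  fix x y assume xy: "x \<in> verts G" "y \<in> verts G"
  then have fxy: "?f x \<in> verts H" "?f y \<in> verts H" "h (?f x) = x" "h (?f y) = y"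
    using f h by (auto simp: bij_betwE bij_betw_inv_into_right)
  have inj: "inj_on h (verts H)" using h by (simp add: bij_betw_def)
  show "{x, y} \<in> edges G \<longleftrightarrow> {?f x, ?f y} \<in> edges H"
  proof
    assume "{x, y} \<in> edges G"
    then obtain E where E: "E \<in> edges H" "h ` E = {x, y}" using eq by auto
    then have "h ` E = h ` {?f x, ?f y}" using fxy by simp
    then have "E = {?f x, ?f y}" using inj_on_image_eq_iff[OF inj H[OF E(1)], of "{?f x, ?f y}"] fxy by auto
    then show "{?f x, ?f y} \<in> edges H" using E by simp
  next
    assume "{?f x, ?f y} \<in> edges H"
    then have "h ` {?f x, ?f y} \<in> edges G" using eq by blast
    then show "{x, y} \<in> edges G" using fxy by simp
  qed
qed

section \<open>The model graph written out explicitly\<close>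

lemma P3_plus_edges_verts:
  "verts (P3_plus_edges p) = Inl ` {0, 1, 2} \<union> Inr ` ({..<p - 2} \<times> {0, 1})"
  by (auto simp: P3_plus_edges_def disjoint_union_def path_graph_def copies_def complete_graph_def Plus_def)

lemma P3_plus_edges_edges:
  "edges (P3_plus_edges p) =
    {{Inl 0, Inl 1}, {Inl 1, Inl 2}} \<union> (\<lambda>i. {Inr (i, 0), Inr (i, 1)}) ` {..<p - 2}"
proof -
  have path: "edges (path_graph 3) = {{0, 1}, {1, 2}}"
    by (auto simp: path_graph_def less_Suc_eq numeral_3_eq_3 numeral_2_eq_2)
  have "{..<2::nat} = {0, 1}" by auto
  moreover have "e = {0, 1}" if "e \<subseteq> {0, 1::nat}" "card e = 2" for e
    by (rule card_subset_eq[OF _ that(1)]) (simp_all add: that(2))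
  ultimately have "edges (complete_graph {..<2::nat}) = {{0, 1}}"
    by (intro equalityI subsetI) (auto simp: complete_graph_def)
  then have copies: "edges (copies m (complete_graph {..<2::nat})) = (\<lambda>i. {(i, 0), (i, 1)}) ` {..<m}" for m
    by (auto simp: copies_def)
  show ?thesis
    by (simp add: P3_plus_edges_def disjoint_union_def path copies image_image)
qed

lemma P3_plus_edges_properties:
  assumes "p \<ge> 2"
  shows "P3_and_matching (edges (P3_plus_edges p))"
    and "card (edges (P3_plus_edges p)) = p"
    and "\<And>e. e \<in> edges (P3_plus_edges p) \<Longrightarrow> e \<subseteq> verts (P3_plus_edges p) \<and> card e = 2"
proof -
  let ?e = "{Inl 0, Inl 1} :: (nat + nat \<times> nat) set"
  let ?f = "{Inl 1, Inl 2} :: (nat + nat \<times> nat) set"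
  let ?g = "\<lambda>i::nat. {Inr (i, 0), Inr (i, 1)} :: (nat + nat \<times> nat) set"
  have ne: "?e \<noteq> ?f" by (auto simp: doubleton_eq_iff)
  have E: "edges (P3_plus_edges p) = {?e, ?f} \<union> ?g ` {..<p - 2}"
    by (rule P3_plus_edges_edges)
  show "P3_and_matching (edges (P3_plus_edges p))"
    unfolding P3_and_matching_def E
    by (rule bexI[of _ ?e], rule bexI[of _ ?f]) (use ne in auto)
  have "inj_on ?g {..<p - 2}" by (auto simp: inj_on_def doubleton_eq_iff)
  then have "card (?g ` {..<p - 2}) = p - 2" by (simp add: card_image)
  moreover have "{?e, ?f} \<inter> ?g ` {..<p - 2} = {}" by auto
  ultimately show "card (edges (P3_plus_edges p)) = p"
    unfolding E using ne assms by (subst card_Un_disjoint) auto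
  show "e \<subseteq> verts (P3_plus_edges p) \<and> card e = 2" if "e \<in> edges (P3_plus_edges p)" for e
    using that unfolding E P3_plus_edges_verts by auto
qed

text \<open>Forwards, shape and size are transported from the model. Backwards, an isomorphism is
  assembled from the meeting pair and an enumeration of the remaining edges.\<close>

lemma graph_iso_P3_plus_edges_iff:
  assumes F: "\<And>e. e \<in> F \<Longrightarrow> card e = 2" and p: "p \<ge> 2"
  shows "graph_iso (deletion_graph F) (P3_plus_edges p) \<longleftrightarrow> P3_and_matching F \<and> card F = p"
proof
  let ?P = "P3_plus_edges p"
  assume "graph_iso (deletion_graph F) ?P"
  then obtain h where "bij_betw h (verts ?P) (verts (deletion_graph F))"
      "edges (deletion_graph F) = (`) h ` edges ?P"
    by (rule graph_iso_edge_image) (use P3_plus_edges_properties(3)[OF p] F in \<open>auto simp: deletion_graph_def\<close>)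
  then have h: "bij_betw h (verts ?P) (\<Union>F)" and eq: "F = (`) h ` edges ?P"
    by (simp_all add: deletion_graph_def)
  have inj: "inj_on h (verts ?P)" using h by (simp add: bij_betw_def)
  show "P3_and_matching F \<and> card F = p"
    unfolding eq
    using P3_and_matching_image[OF inj _ P3_plus_edges_properties(1)[OF p]]
      card_image[OF inj_on_image_sets[OF inj, of "edges ?P"]]
      P3_plus_edges_properties(2,3)[OF p] by simp
next
  let ?P = "P3_plus_edges p"
  assume asm: "P3_and_matching F \<and> card F = p"
  then obtain e f where ef: "e \<in> F" "f \<in> F" "e \<noteq> f" "e \<inter> f \<noteq> {}"
    and disj: "\<forall>g\<in>F - {e, f}. \<forall>g'\<in>F - {g}. g \<inter> g' = {}"
    unfolding P3_and_matching_def by (elim conjE bexE)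
  obtain a b c where "e = {a, b}" "f = {b, c}" "a \<noteq> b" "b \<noteq> c" and ac: "a \<noteq> c"
    using F[OF ef(1)] F[OF ef(2)] ef(3,4) by (rule edge_pairE)
  then have e: "e = {a, b}" "a \<noteq> b" and f: "f = {b, c}" "c \<noteq> b" by simp_all
  \<comment> \<open>Infinite sets have cardinality 0, so \<open>p \<ge> 2\<close> forces
    finiteness.\<close>
  have fin: "finite F" using asm p by (metis card.infinite not_numeral_le_zero)
  define G where "G = F - {e, f}"
  have FG: "F = {e, f} \<union> G" using ef by (auto simp: G_def)
  have "card G = p - 2" "finite G"
    using ef fin asm by (auto simp: G_def card_Diff_subset)
  then obtain k where k: "bij_betw k {..<p - 2} G"
    using ex_bij_betw_nat_finite[of G] by (auto simp: atLeast0LessThan)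
  have "\<forall>i\<in>{..<p - 2}. \<exists>u w. k i = {u, w} \<and> u \<noteq> w"
  proof
    fix i assume "i \<in> {..<p - 2}"
    then have "k i \<in> F" using bij_betw_apply[OF k] G_def by blast
    then have "card (k i) = 2" by (rule F)
    then show "\<exists>u w. k i = {u, w} \<and> u \<noteq> w" unfolding card_2_iff .
  qed
  then obtain u w where "\<forall>i\<in>{..<p - 2}. k i = {u i, w i} \<and> u i \<noteq> w i"
    unfolding bchoice_iff by (elim exE)
  then have uw: "k i = {u i, w i} \<and> u i \<noteq> w i" if "i < p - 2" for i
    using that by simp
  \<comment> \<open>The middle path vertex \<open>Inl 1\<close> goes to the shared endpoint
    \<open>b\<close>; \<open>Inr (i, 0)\<close> and \<open>Inr (i, 1)\<close> go to the two ends of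
    the edge numbered \<open>i\<close>.\<close>
  define h where "h = case_sum (\<lambda>i::nat. if i = 0 then a else if i = 1 then b else c)
      (\<lambda>(i, j::nat). if j = 0 then u i else w i)"
  have kdisj: "k i \<inter> k j = {}" if "i < p - 2" "j < p - 2" "i \<noteq> j" for i j
  proof -
    have "k i \<in> G" "k j \<in> G" "k i \<noteq> k j"
      using bij_betw_apply[OF k] inj_on_contraD[OF bij_betw_imp_inj_on[OF k]] that by simp_all
    then show ?thesis using disj unfolding G_def by blast
  qed
  have kef: "k i \<inter> {a, b, c} = {}" if "i < p - 2" for i
  proof -
    have "k i \<in> G" using bij_betw_apply[OF k] that by simp
    then have "k i \<inter> e = {}" "k i \<inter> f = {}" using disj ef unfolding G_def by blast+
    then show ?thesis unfolding e f by blast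
  qed
  have edges: "F = (`) h ` edges ?P"
  proof -
    have "(\<lambda>i. {u i, w i}) ` {..<p - 2} = k ` {..<p - 2}"
      by (rule image_cong) (use uw in auto)
    then show ?thesis
      unfolding P3_plus_edges_edges FG using k
      by (simp add: image_Un image_image h_def e f bij_betw_def)
  qed
  \<comment> \<open>Path vertices land in \<open>{a, b, c}\<close> and \<open>Inr (i, j)\<close>
    lands in \<open>k i\<close>. These sets are pairwise disjoint, so a collision could only occur
    within one piece.\<close>
  have "inj_on h (verts ?P)"
    unfolding P3_plus_edges_verts
  proof (rule inj_onI)
    fix x y assume xy: "x \<in> Inl ` {0, 1, 2} \<union> Inr ` ({..<p - 2} \<times> {0, 1})"
      "y \<in> Inl ` {0, 1, 2} \<union> Inr ` ({..<p - 2} \<times> {0, 1})" "h x = h y"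
    have inl: "h (Inl i) \<in> {a, b, c}" for i by (simp add: h_def)
    have inr: "h (Inr (i, j)) \<in> k i" if "i < p - 2" for i j using uw[OF that] by (simp add: h_def)
    show "x = y"
    proof (cases x)
      case x: (Inl i)
      show ?thesis
      proof (cases y)
        case y: (Inl j)
        then show ?thesis using x xy e f ac by (auto simp: h_def split: if_splits)
      next
        case y: (Inr q)
        then show ?thesis using x xy inl[of i] inr[of "fst q" "snd q"] kef[of "fst q"] by auto
      qed
    next
      case x: (Inr q)
      show ?thesis
      proof (cases y)
        case y: (Inl j)
        then show ?thesis using x xy inl[of j] inr[of "fst q" "snd q"] kef[of "fst q"] by auto
      next
        case y: (Inr r)
        have q: "fst q < p - 2" "snd q \<in> {0, 1}" and r: "fst r < p - 2" "snd r \<in> {0, 1}"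
          using xy x y by auto
        have "fst q = fst r"
        proof (rule ccontr)
          assume "fst q \<noteq> fst r"
          then have "k (fst q) \<inter> k (fst r) = {}" using kdisj q r by blast
          then show False using inr[of "fst q" "snd q"] inr[of "fst r" "snd r"] q r x y xy(3) by auto
        qed
        moreover have "snd q = snd r"
          using uw[OF q(1)] q r xy(3) \<open>fst q = fst r\<close> x y
          by (cases q; cases r) (auto simp: h_def)
        ultimately show ?thesis using x y by (simp add: prod_eq_iff)
      qed
    qed
  qed
  moreover have "h ` verts ?P = \<Union>F"
  proof -
    \<comment> \<open>The model has no isolated vertices, so the image of its edges determines that
      of its vertices.\<close>
    have "verts ?P = \<Union>(edges ?P)"
      unfolding P3_plus_edges_verts P3_plus_edges_edges by auto
    then show ?thesis by (metis edges image_Union)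
  qed
  ultimately show "graph_iso (deletion_graph F) ?P"
    using edges P3_plus_edges_properties(3)[OF p]
    by (intro graph_iso_of_edge_image[of h]) (auto simp: deletion_graph_def bij_betw_def)
qed

section \<open>The Laplacian of a complement\<close>

text \<open>For two-element \<open>e\<close> this is the Laplacian of a single edge. The entrywise
  form avoids choosing an orientation.\<close>

definition edge_laplacian :: "'v::finite set \<Rightarrow> real^'v^'v" where
  "edge_laplacian e = (\<chi> i j. if i \<in> e \<and> j \<in> e then if i = j then 1 else - 1 else 0)"

definition ones :: "real^'v^'v::finite" where
  "ones = (\<chi> i j. 1)"

text \<open>For \<open>F \<subseteq> E(K\<^sub>n)\<close> this is the Laplacian of \<open>K\<^sub>n - F\<close> plus the all-ones matrix, which
  makes it invertible when \<open>K\<^sub>n - F\<close> is connected.\<close>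

definition complement_matrix :: "'v::finite set set \<Rightarrow> real^'v^'v" where
  "complement_matrix F = real CARD('v) *\<^sub>R mat 1 - (\<Sum>e\<in>F. edge_laplacian e)"

lemma edge_laplacian_doubleton:
  "x \<noteq> y \<Longrightarrow> edge_laplacian {x, y} = outer (axis x 1 - axis y 1)"
  by (auto simp: vec_eq_iff edge_laplacian_def outer_def axis_def)

lemma edge_vector:
  assumes "card e = 2"
  obtains x y where "x \<noteq> y" "e = {x, y}" "edge_laplacian e = outer (axis x 1 - axis y 1)"
proof -
  obtain x y where "e = {x, y}" "x \<noteq> y" using assms card_2_iff by meson
  then show thesis using that edge_laplacian_doubleton by blast
qed

lemma inner_edge_laplacian_doubleton:
  "x \<noteq> y \<Longrightarrow> z \<bullet> (edge_laplacian {x, y} *v z) = (z $ x - z $ y)\<^sup>2"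
  by (simp add: edge_laplacian_doubleton outer_mult_vec inner_diff_left inner_diff_right inner_axis
      inner_commute[of "axis _ _"] power2_eq_square algebra_simps)

lemma inner_edge_laplacian_nonneg:
  "card e = 2 \<Longrightarrow> z \<bullet> (edge_laplacian e *v z) \<ge> 0"
  by (elim edge_vector) (simp add: outer_mult_vec inner_commute)

lemma transpose_edge_laplacian: "transpose (edge_laplacian e) = edge_laplacian e"
  by (auto simp: vec_eq_iff edge_laplacian_def transpose_def)

lemma transpose_complement_matrix: "transpose (complement_matrix F) = complement_matrix F"
  by (simp add: complement_matrix_def transpose_diff transpose_sum transpose_edge_laplacian
      transpose_mat transpose_scalar)

lemma complement_matrix_mult_vec:
  "complement_matrix F *v (x :: real^'v::finite)
    = real CARD('v) *\<^sub>R x - (\<Sum>e\<in>F. edge_laplacian e *v x)"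
  by (simp add: complement_matrix_def matrix_vector_mult_diff_rdistrib sum_matrix_vector_mult
      scaleR_matrix_vector_assoc[symmetric])

lemma inner_complement_matrix:
  "(x :: real^'v::finite) \<bullet> (complement_matrix F *v x)
    = real CARD('v) * (x \<bullet> x) - (\<Sum>e\<in>F. x \<bullet> (edge_laplacian e *v x))"
  by (simp add: complement_matrix_mult_vec inner_diff_right inner_sum_right)

lemma complement_matrix_insert:
  assumes "e \<notin> F"
  shows "complement_matrix (insert e F) = complement_matrix F - edge_laplacian (e :: 'v::finite set)"
proof -
  have "finite F" by (rule finite)
  then show ?thesis using assms by (simp add: complement_matrix_def)
qed

section \<open>The Kirchhoff index as a trace\<close>

text \<open>A diagonal entry counts the edges at \<open>i\<close>; off the diagonal only the edge
  \<open>{i, j}\<close> contributes.\<close>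

lemma laplacian_eq_sum:
  fixes G :: "'v::finite sgraph"
  assumes "\<And>e. e \<in> edges G \<Longrightarrow> card e = 2"
  shows "laplacian G = (\<Sum>e\<in>edges G. edge_laplacian e)"
proof -
  have "laplacian G $ i $ j = (\<Sum>e\<in>edges G. edge_laplacian e $ i $ j)" for i j
  proof (cases "i = j")
    case True
    have "{i, i} \<notin> edges G" using assms[of "{i, i}"] by auto
    moreover have "(\<Sum>e\<in>edges G. edge_laplacian e $ i $ i) = (\<Sum>e\<in>{e \<in> edges G. i \<in> e}. 1)"
      by (rule sum.mono_neutral_cong_right) (auto simp: edge_laplacian_def)
    ultimately show ?thesis using True
      by (simp add: laplacian_def degree_matrix_def adjacency_matrix_def)
  next
    case False
    have "edge_laplacian e $ i $ j = (if e = {i, j} then - 1 else 0)" if e: "e \<in> edges G" for e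
    proof -
      obtain x y where "e = {x, y}" using assms[OF e] card_2_iff by meson
      then show ?thesis using False by (auto simp: edge_laplacian_def)
    qed
    then have "(\<Sum>e\<in>edges G. edge_laplacian e $ i $ j) = (\<Sum>e\<in>edges G. if e = {i, j} then - 1 else 0)"
      by (rule sum.cong[OF refl])
    then show ?thesis using False
      by (simp add: laplacian_def degree_matrix_def adjacency_matrix_def)
  qed
  then show ?thesis by (simp add: vec_eq_iff)
qed

text \<open>The edges at \<open>i\<close> correspond to the other vertices, so every degree is
  \<open>CARD('v) - 1\<close>.\<close>

lemma laplacian_complete_graph:
  "laplacian (complete_graph (UNIV :: 'v::finite set)) = real CARD('v) *\<^sub>R mat 1 - ones"
proof -
  have "{e \<in> edges (complete_graph (UNIV :: 'v set)). i \<in> e} = (\<lambda>j. {i, j}) ` (UNIV - {i})" for i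
  proof (intro equalityI subsetI)
    fix e assume "e \<in> {e \<in> edges (complete_graph (UNIV :: 'v set)). i \<in> e}"
    then have "card (e - {i}) = 1" "i \<in> e" by (auto simp: complete_graph_def)
    then obtain j where "e - {i} = {j}" "i \<in> e" by (meson card_1_singletonE)
    then have "e = {i, j}" "j \<noteq> i" by auto
    then show "e \<in> (\<lambda>j. {i, j}) ` (UNIV - {i})" by blast
  qed (auto simp: complete_graph_def)
  moreover have "inj_on (\<lambda>j. {i, j}) (UNIV - {i})" for i :: 'v
    by (auto simp: inj_on_def doubleton_eq_iff)
  moreover have "{i, j} \<in> edges (complete_graph (UNIV :: 'v set)) \<longleftrightarrow> i \<noteq> j" for i j
    by (auto simp: complete_graph_def card_insert_if)
  ultimately show ?thesis
    by (simp add: vec_eq_iff laplacian_def degree_matrix_def adjacency_matrix_def ones_def mat_def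
        card_image card_Diff_subset of_nat_diff Suc_leI)
qed

context
  fixes F :: "'v::finite set set"
  assumes F: "F \<subseteq> edges (complete_graph UNIV)"
begin

lemma laplacian_delete_edges:
  "laplacian (delete_edges (complete_graph UNIV) F) = complement_matrix F - ones"
proof -
  let ?E = "edges (complete_graph (UNIV :: 'v set))"
  have E: "\<And>e. e \<in> ?E \<Longrightarrow> card e = 2" by (simp add: complete_graph_def)
  have "laplacian (delete_edges (complete_graph UNIV) F) = (\<Sum>e\<in>?E - F. edge_laplacian e)"
    using laplacian_eq_sum[of "delete_edges (complete_graph UNIV) F"] E by (simp add: delete_edges_def)
  also have "\<dots> = (\<Sum>e\<in>?E. edge_laplacian e) - (\<Sum>e\<in>F. edge_laplacian e)"
    by (rule sum_diff) (use F in auto)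
  also have "(\<Sum>e\<in>?E. edge_laplacian e) = real CARD('v) *\<^sub>R mat 1 - ones"
    using laplacian_eq_sum[of "complete_graph (UNIV :: 'v set)"] E by (simp add: laplacian_complete_graph)
  finally show ?thesis by (simp add: complement_matrix_def)
qed

lemma card_edge: "e \<in> F \<Longrightarrow> card e = 2"
  using F by (auto simp: complete_graph_def)

text \<open>Each edge vector has entry sum zero, so the constant vector, written \<open>1\<close> in
  the proof, is an eigenvector; the columns of \<open>ones\<close> are copies of it.\<close>

lemma complement_matrix_mult_ones:
  "complement_matrix F ** ones = real CARD('v) *\<^sub>R ones"
proof -
  have "edge_laplacian e *v 1 = 0" if "e \<in> F" for e
    using card_edge[OF that]
    by (elim edge_vector) (simp add: outer_mult_vec inner_diff_left inner_axis' )
  then have "complement_matrix F *v 1 = real CARD('v) *\<^sub>R 1"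
    by (simp add: complement_matrix_mult_vec)
  then show ?thesis
    by (simp add: vec_eq_iff matrix_matrix_mult_def matrix_vector_mult_def ones_def)
qed

text \<open>The form is the sum of squared differences over the remaining edges plus the squared
  entry sum. If it vanishes, connectivity makes \<open>x\<close> constant and the last term makes
  that constant zero.\<close>

lemma pos_def_of_connected:
  assumes "graph_connected (delete_edges (complete_graph UNIV) F)"
  shows "pos_def (complement_matrix F)"
  unfolding pos_def_def
proof (intro allI impI)
  fix x :: "real^'v" assume x: "x \<noteq> 0"
  let ?E = "edges (delete_edges (complete_graph (UNIV :: 'v set)) F)"
  have E: "\<And>e. e \<in> ?E \<Longrightarrow> card e = 2" by (simp add: delete_edges_def complete_graph_def)
  have nonneg: "\<And>e. e \<in> ?E \<Longrightarrow> 0 \<le> x \<bullet> (edge_laplacian e *v x)"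
    using E by (intro inner_edge_laplacian_nonneg)
  define s where "s = (\<Sum>i\<in>UNIV. x $ i)"
  have "ones *v x = (\<chi> i. s)"
    by (simp add: vec_eq_iff ones_def matrix_vector_mult_def s_def)
  then have "x \<bullet> (ones *v x) = s\<^sup>2"
    by (simp add: inner_vec_def s_def power2_eq_square flip: sum_distrib_right)
  moreover have "complement_matrix F = (\<Sum>e\<in>?E. edge_laplacian e) + ones"
    using laplacian_delete_edges laplacian_eq_sum[OF E] by (simp add: algebra_simps)
  ultimately have eq: "x \<bullet> (complement_matrix F *v x) = (\<Sum>e\<in>?E. x \<bullet> (edge_laplacian e *v x)) + s\<^sup>2"
    by (simp add: matrix_vector_mult_add_rdistrib sum_matrix_vector_mult inner_add_right inner_sum_right)
  have sum: "(\<Sum>e\<in>?E. x \<bullet> (edge_laplacian e *v x)) \<ge> 0"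
    using nonneg by (rule sum_nonneg)
  show "0 < x \<bullet> (complement_matrix F *v x)"
  proof (rule ccontr)
    assume "\<not> 0 < x \<bullet> (complement_matrix F *v x)"
    then have "(\<Sum>e\<in>?E. x \<bullet> (edge_laplacian e *v x)) + s\<^sup>2 = 0"
      using eq sum zero_le_power2[of s] by linarith
    then have s0: "s = 0" and "(\<Sum>e\<in>?E. x \<bullet> (edge_laplacian e *v x)) = 0"
      using sum by (auto simp: add_nonneg_eq_0_iff)
    then have *: "x \<bullet> (edge_laplacian e *v x) = 0" if "e \<in> ?E" for e
      using that nonneg by (simp add: sum_nonneg_eq_0_iff)
    have adj: "x $ i = x $ j" if "{i, j} \<in> ?E" for i j
    proof (cases "i = j")
      case False
      then show ?thesis using *[OF that] inner_edge_laplacian_doubleton[of i j x] by simp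
    qed simp
    have "x $ i = x $ j" for i j
    proof -
      have "(i, j) \<in> {(u, v). {u, v} \<in> ?E}\<^sup>*"
        using assms by (simp add: graph_connected_def) (simp add: delete_edges_def complete_graph_def)
      then show ?thesis by (induction rule: rtrancl_induct) (use adj in auto)
    qed
    then have "s = (\<Sum>i\<in>(UNIV :: 'v set). x $ j)" for j
      unfolding s_def by (intro sum.cong) auto
    then have "x $ j = 0" for j using s0 by simp
    then show False using x by (simp add: vec_eq_iff)
  qed
qed

text \<open>The Laplacian and \<open>M\<close> differ only on constant vectors, so the pseudoinverse
  is \<open>X\<close> with its constant part removed. Summing resistances over unordered pairs gives
  \<open>n * trace X\<close> minus the sum of all entries of \<open>X\<close>, which is 1.\<close>

lemma kirchhoff_index_eq_trace:
  assumes pd: "pos_def (complement_matrix F)"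
  shows "kirchhoff_index (delete_edges (complete_graph UNIV) F)
    = real CARD('v) * trace (matrix_inv (complement_matrix F)) - 1"
proof -
  define n where "n = real CARD('v)"
  define M where "M = complement_matrix F"
  define X where "X = matrix_inv M"
  define L where "L = laplacian (delete_edges (complete_graph UNIV) F)"
  \<comment> \<open>Both \<open>X\<close> and \<open>(1 / n\<^sup>2) *\<^sub>R ones\<close> act as
    \<open>1 / n\<close> on constant vectors, so the difference kills them.\<close>
  define P where "P = X - (1 / n\<^sup>2) *\<^sub>R ones"
  have n: "n > 0" by (simp add: n_def)
  have MX: "M ** X = mat 1" and XM: "X ** M = mat 1"
    using pos_def_invertible[OF pd] by (simp_all add: X_def M_def)
  have L: "L = M - ones" by (simp add: L_def M_def laplacian_delete_edges)
  have tM: "transpose M = M" by (simp add: M_def transpose_complement_matrix)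
  have tX: "transpose X = X" using transpose_matrix_inv[OF pd] tM by (simp add: X_def M_def)
  have tJ: "transpose ones = (ones :: real^'v^'v)"
    by (simp add: vec_eq_iff transpose_def ones_def)
  have MJ: "M ** ones = n *\<^sub>R ones" by (simp add: M_def n_def complement_matrix_mult_ones)
  then have JM: "ones ** M = n *\<^sub>R ones"
    by (metis tJ tM matrix_transpose_mul transpose_scalar)
  have JJ: "ones ** ones = n *\<^sub>R (ones :: real^'v^'v)"
    by (simp add: vec_eq_iff matrix_matrix_mult_def ones_def n_def)
  have "n *\<^sub>R (X ** ones) = X ** (M ** ones)"
    by (simp add: MJ matrix_scaleR_right)
  also have "\<dots> = ones" by (simp add: matrix_mul_assoc XM)
  finally have "(1 / n) *\<^sub>R (n *\<^sub>R (X ** ones)) = (1 / n) *\<^sub>R ones" by simp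
  then have XJ: "X ** ones = (1 / n) *\<^sub>R ones" using n by simp
  then have JX: "ones ** X = (1 / n) *\<^sub>R ones"
    by (metis tJ tX matrix_transpose_mul transpose_scalar)
  note dist = matrix_diff_ldistrib matrix_diff_rdistrib matrix_scaleR_left matrix_scaleR_right
  \<comment> \<open>Both products are the orthogonal projection onto the vectors of entry sum zero,
    hence symmetric.\<close>
  have LP: "L ** P = mat 1 - (1 / n) *\<^sub>R ones"
    using n by (simp add: L P_def dist MX MJ JX JJ power2_eq_square)
  have PL: "P ** L = mat 1 - (1 / n) *\<^sub>R ones"
    using n by (simp add: L P_def dist XM JM XJ JJ power2_eq_square)
  have LJ: "L ** ones = 0" by (simp add: L dist MJ JJ)
  have PJ: "P ** ones = 0" using n by (simp add: P_def dist XJ JJ power2_eq_square)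
  have mp: "is_moore_penrose L P"
    unfolding is_moore_penrose_def
  proof (intro conjI)
    show "L ** P ** L = L"
      by (simp add: PL dist LJ flip: matrix_mul_assoc)
    show "P ** L ** P = P"
      by (simp add: LP dist PJ flip: matrix_mul_assoc)
    show "transpose (L ** P) = L ** P" "transpose (P ** L) = P ** L"
      by (simp_all add: LP PL transpose_diff transpose_scalar transpose_mat tJ)
  qed
  then have "moore_penrose L = P"
    unfolding moore_penrose_def by (rule the_equality) (rule is_moore_penrose_unique[OF _ mp])
  moreover have "axis x 1 \<bullet> (P *v axis y 1) = P $ x $ y" for x y
    by (simp add: inner_axis' matrix_vector_mul_component inner_axis)
  \<comment> \<open>The \<open>ones\<close> part of \<open>P\<close> enters all four terms with the
    same size and cancels.\<close>
  ultimately have R: "eff_resistance (delete_edges (complete_graph UNIV) F) x y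
      = X $ x $ x + X $ y $ y - X $ x $ y - X $ y $ x" for x y
    by (simp add: eff_resistance_def flip: L_def)
      (simp add: matrix_vector_mult_diff_distrib inner_diff_left inner_diff_right P_def ones_def)
  have row: "(\<Sum>y\<in>UNIV. X $ x $ y) = 1 / n" for x
    using XJ by (simp add: vec_eq_iff matrix_matrix_mult_def ones_def)
  have all: "(\<Sum>x\<in>UNIV. \<Sum>y\<in>UNIV. X $ x $ y) = 1"
    using n by (simp add: row) (simp add: n_def)
  then have all': "(\<Sum>x\<in>UNIV. \<Sum>y\<in>UNIV. X $ y $ x) = 1"
    by (subst sum.swap)
  \<comment> \<open>The term at \<open>y = x\<close> is zero, so each inner sum may run over all
    vertices.\<close>
  have "(\<Sum>y\<in>UNIV - {x}. X $ x $ x + X $ y $ y - X $ x $ y - X $ y $ x)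
      = (\<Sum>y\<in>UNIV. X $ x $ x + X $ y $ y - X $ x $ y - X $ y $ x)" for x
    by (rule sum.mono_neutral_left) auto
  then have "2 * kirchhoff_index (delete_edges (complete_graph UNIV) F)
      = (\<Sum>x\<in>UNIV. \<Sum>y\<in>UNIV. X $ x $ x + X $ y $ y - X $ x $ y - X $ y $ x)"
    unfolding kirchhoff_index_def R by (simp add: delete_edges_def complete_graph_def)
  also have "\<dots> = 2 * n * trace X - 2"
    by (simp add: sum.distrib sum_subtractf all all' trace_def n_def flip: sum_distrib_left)
  finally show ?thesis by (simp add: n_def X_def M_def)
qed

end

section \<open>Adding deleted edges one at a time\<close>

context
  fixes F :: "'v::finite set set" and e :: "'v set"
  assumes card2: "\<And>g. g \<in> insert e F \<Longrightarrow> card g = 2" and eF: "e \<notin> F"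
    and pd: "pos_def (complement_matrix (insert e F))"
begin

lemma pos_def_complement_matrix_remove: "pos_def (complement_matrix F)"
proof -
  obtain x y where "edge_laplacian e = outer (axis x 1 - axis y 1)"
    using card2[of e] by (auto elim: edge_vector)
  then show ?thesis
    using pd pos_def_add_outer transpose_complement_matrix by (metis complement_matrix_insert[OF eF])
qed

text \<open>The rank-one bounds apply with \<open>c = CARD('v)\<close> and
  \<open>b \<bullet> b = 2\<close>. The defect is the sum of the forms of the edges in
  \<open>F\<close> at \<open>b\<close>: an edge meeting \<open>e\<close> contributes a positive
  amount, and if all avoid \<open>e\<close> then \<open>b\<close> is an eigenvector.\<close>

lemma trace_increment_ge:
  "trace (matrix_inv (complement_matrix (insert e F))) \<ge>
     trace (matrix_inv (complement_matrix F)) + 2 / (real CARD('v) * (real CARD('v) - 2))"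
  (is ?ge)
and trace_increment_gt:
  "g \<in> F \<Longrightarrow> e \<inter> g \<noteq> {} \<Longrightarrow> trace (matrix_inv (complement_matrix (insert e F))) >
     trace (matrix_inv (complement_matrix F)) + 2 / (real CARD('v) * (real CARD('v) - 2))"
  (is "_ \<Longrightarrow> _ \<Longrightarrow> ?gt")
and trace_increment_eq:
  "(\<And>g. g \<in> F \<Longrightarrow> e \<inter> g = {}) \<Longrightarrow> trace (matrix_inv (complement_matrix (insert e F))) =
     trace (matrix_inv (complement_matrix F)) + 2 / (real CARD('v) * (real CARD('v) - 2))"
  (is "PROP _ \<Longrightarrow> ?eq")
proof -
  obtain x y where xy: "x \<noteq> y" "e = {x, y}" "edge_laplacian e = outer (axis x 1 - axis y 1)"
    using card2[of e] by (auto elim: edge_vector)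
  define b :: "real^'v" where "b = axis x 1 - axis y 1"
  have M: "complement_matrix (insert e F) = complement_matrix F - outer b"
    using complement_matrix_insert[OF eF] xy by (simp add: b_def)
  have pd': "pos_def (complement_matrix F - outer b)" using pd M by simp
  have bx: "b $ x = 1" "b $ y = - 1" "\<And>i. i \<notin> e \<Longrightarrow> b $ i = 0"
    using xy by (auto simp: b_def axis_def)
  have bb: "b \<bullet> b = 2"
    using xy by (simp add: b_def inner_diff_left inner_diff_right inner_axis_axis)
  then have b0: "b \<noteq> 0" by auto
  have n: "real CARD('v) > 0" by simp
  have nonneg: "0 \<le> z \<bullet> (edge_laplacian g *v z)" if "g \<in> F" for g and z :: "real^'v"
    using that card2 by (intro inner_edge_laplacian_nonneg) auto
  have le: "z \<bullet> (complement_matrix F *v z) \<le> real CARD('v) * (z \<bullet> z)" for z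
    using sum_nonneg[of F "\<lambda>g. z \<bullet> (edge_laplacian g *v z)"] nonneg
    by (simp add: inner_complement_matrix)
  show ?ge
    using trace_inv_increment_ge[OF pd' transpose_complement_matrix n le b0] by (simp add: M bb)
  {
    assume g: "g \<in> F" "e \<inter> g \<noteq> {}"
    obtain u v where uv: "u \<noteq> v" "g = {u, v}" using card2[of g] g card_2_iff by (metis insertCI)
    \<comment> \<open>Exactly one endpoint of \<open>g\<close> lies in \<open>e\<close>; there
      \<open>b\<close> is \<open>1\<close> or \<open>- 1\<close>, and at the other endpoint it is
      \<open>0\<close>.\<close>
    have "b $ u \<noteq> b $ v"
    proof -
      have "g \<noteq> e" using g eF by auto
      then have "{u, v} \<noteq> {x, y}" using uv xy by simp
      moreover have "u \<in> {x, y} \<or> v \<in> {x, y}" using g uv xy by auto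
      ultimately show ?thesis using bx(1,2) bx(3)[of u] bx(3)[of v] xy uv by auto
    qed
    then have "0 < b \<bullet> (edge_laplacian g *v b)"
      using inner_edge_laplacian_doubleton[OF uv(1)] uv by simp
    also have "\<dots> \<le> (\<Sum>g\<in>F. b \<bullet> (edge_laplacian g *v b))"
      using g nonneg by (intro member_le_sum) auto
    finally have "b \<bullet> (complement_matrix F *v b) < real CARD('v) * (b \<bullet> b)"
      by (simp add: inner_complement_matrix)
    then show ?gt
      using trace_inv_increment_gt[OF pd' transpose_complement_matrix n le b0] by (simp add: M bb)
  }
  {
    assume disj: "\<And>g. g \<in> F \<Longrightarrow> e \<inter> g = {}"
    have "edge_laplacian g *v b = 0" if g: "g \<in> F" for g
    proof -
      obtain u v where uv: "u \<noteq> v" "g = {u, v}" "edge_laplacian g = outer (axis u 1 - axis v 1)"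
        using card2[of g] g by (auto elim: edge_vector)
      have "b $ u = 0" "b $ v = 0" using disj[OF g] uv bx(3) by auto
      then show ?thesis unfolding uv(3) by (simp add: outer_mult_vec inner_diff_left inner_axis')
    qed
    then have "complement_matrix F *v b = real CARD('v) *\<^sub>R b"
      by (simp add: complement_matrix_mult_vec)
    then show ?eq
      using trace_inv_increment_eq[OF pd' transpose_complement_matrix _ n] by (simp add: M bb)
  }
qed

end

section \<open>The starting point: no edge, then two edges sharing an endpoint\<close>

lemma matrix_inv_complement_matrix_empty:
  "matrix_inv (complement_matrix {} :: real^'v^'v::finite) = (1 / real CARD('v)) *\<^sub>R mat 1"
  by (rule matrix_inv_eqI) (simp add: complement_matrix_def matrix_scaleR_left matrix_scaleR_right)

text \<open>Behind the value: the Laplacian of a path on three vertices has eigenvalues 0, 1 and 3,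
  so two of the terms \<open>1 / n\<close> in the trace become \<open>1 / (n - 1)\<close> and
  \<open>1 / (n - 3)\<close>. The computation itself uses two Sherman-Morrison steps from a multiple
  of the identity.\<close>

lemma trace_inv_path:
  fixes e f :: "'v::finite set"
  assumes card: "card e = 2" "card f = 2" and ef: "e \<noteq> f" "e \<inter> f \<noteq> {}"
    and pd: "pos_def (complement_matrix {e, f})" and n4: "CARD('v) \<ge> 4"
  shows "trace (matrix_inv (complement_matrix {e, f}))
    = 1 + 3 / (real CARD('v) * (real CARD('v) - 3)) + 1 / (real CARD('v) * (real CARD('v) - 1))"
proof -
  define n where "n = real CARD('v)"
  have n: "n \<ge> 4" using n4 by (simp add: n_def)
  obtain x y z where xyz: "e = {x, y}" "f = {y, z}" "x \<noteq> y" "y \<noteq> z" "x \<noteq> z"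
    using card ef by (rule edge_pairE)
  \<comment> \<open>Orienting both edges along the path gives
    \<open>b \<bullet> c = - 1\<close>.\<close>
  define b c :: "real^'v" where "b = axis x 1 - axis y 1" and "c = axis y 1 - axis z 1"
  have bc: "b \<bullet> b = 2" "c \<bullet> c = 2" "b \<bullet> c = - 1" "c \<bullet> b = - 1"
    using xyz by (simp_all add: b_def c_def inner_diff_left inner_diff_right inner_axis_axis)
  define A where "A = complement_matrix {e}"
  define I :: "real^'v^'v" where "I = complement_matrix {}"
  have A: "A = I - outer b"
    using complement_matrix_insert[of e "{}"] xyz edge_laplacian_doubleton[of x y]
    by (simp add: A_def I_def b_def)
  have "complement_matrix (insert f {e}) = A - outer c"
    using complement_matrix_insert[of f "{e}"] xyz ef(1) edge_laplacian_doubleton[of y z]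
    by (auto simp: A_def c_def)
  then have M: "complement_matrix {e, f} = A - outer c" by (simp add: insert_commute)
  have tA: "transpose A = A" and tI: "transpose I = I"
    by (simp_all add: A_def I_def transpose_complement_matrix)
  have pdM: "pos_def (A - outer c)" using pd M by simp
  have pdA: "pos_def (I - outer b)" using pos_def_add_outer[OF pdM tA] A by simp
  have pdI: "pos_def I" by (rule pos_def_add_outer[OF pdA tI])
  have invI: "matrix_inv I *v u = (1 / n) *\<^sub>R u" for u
    by (simp add: I_def matrix_inv_complement_matrix_empty n_def scaleR_matrix_vector_assoc[symmetric])
  have "b \<bullet> (matrix_inv I *v b) \<noteq> 1" using n by (simp add: invI bc)
  from matrix_inv_minus_outer[OF pdI tI this]
  have "matrix_inv A = matrix_inv I + (1 / (1 - 2 / n)) *\<^sub>R outer ((1 / n) *\<^sub>R b)"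
    by (simp add: A invI bc)
  then have "matrix_inv A *v c = (1 / n) *\<^sub>R c + (1 / (1 - 2 / n) * (1 / n * (- 1)) * (1 / n)) *\<^sub>R b"
    by (simp add: matrix_vector_mult_add_rdistrib invI scaleR_matrix_vector_assoc[symmetric]
        outer_mult_vec bc)
  also have "1 / (1 - 2 / n) * (1 / n * (- 1)) * (1 / n) = - 1 / (n * (n - 2))"
    using n by (simp add: field_simps)
  finally have v: "matrix_inv A *v c = (1 / n) *\<^sub>R c + (- 1 / (n * (n - 2))) *\<^sub>R b" .
  have 1: "c \<bullet> (matrix_inv A *v c) = 2 / n + 1 / (n * (n - 2))"
    by (simp add: v inner_diff_right bc)
  have 2: "(matrix_inv A *v c) \<bullet> (matrix_inv A *v c)
      = 2 / n\<^sup>2 + 2 / (n\<^sup>2 * (n - 2)) + 2 / (n\<^sup>2 * (n - 2)\<^sup>2)"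
    unfolding v by (simp add: inner_add_right inner_add_left bc power2_eq_square algebra_simps)
  have "trace (matrix_inv A) = trace (matrix_inv I) + 2 / (n * (n - 2))"
    using trace_inv_minus_outer[OF pdA tI] n by (simp add: A invI bc field_simps)
  also have "trace (matrix_inv I) = 1"
    by (simp add: I_def matrix_inv_complement_matrix_empty trace_scaleR trace_I)
  finally have trA: "trace (matrix_inv A) = 1 + 2 / (n * (n - 2))" .
  have "1 - (2 / n + 1 / (n * (n - 2))) = (n - 1) * (n - 3) / (n * (n - 2))"
    using n by (simp add: field_simps)
  moreover have "2 / n\<^sup>2 + 2 / (n\<^sup>2 * (n - 2)) + 2 / (n\<^sup>2 * (n - 2)\<^sup>2)
      = 2 * (n\<^sup>2 - 3 * n + 3) / (n\<^sup>2 * (n - 2)\<^sup>2)"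
    using n by (simp add: divide_simps) (simp add: power2_eq_square algebra_simps)
  ultimately have "trace (matrix_inv (A - outer c))
      = 1 + 2 / (n * (n - 2))
        + 2 * (n\<^sup>2 - 3 * n + 3) / (n\<^sup>2 * (n - 2)\<^sup>2) / ((n - 1) * (n - 3) / (n * (n - 2)))"
    unfolding trace_inv_minus_outer[OF pdM tA] 1 2 trA by simp
  also have "\<dots> = 1 + 3 / (n * (n - 3)) + 1 / (n * (n - 1))"
    using n by (simp add: divide_simps power2_eq_square) algebra
  finally show ?thesis by (simp add: M n_def)
qed

text \<open>The edges of \<open>G\<close> are added one by one, each contributing at least
  \<open>\<delta>\<close>. Total equality forces equality at every step, so each new edge avoids all
  earlier ones; by symmetry this means that each edge of \<open>G\<close> avoids all others.\<close>

lemma trace_inv_union: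
  fixes G :: "'v::finite set set"
  assumes card2: "\<And>g. g \<in> B \<union> G \<Longrightarrow> card g = 2" and "B \<inter> G = {}"
    and pd: "pos_def (complement_matrix (B \<union> G))"
  defines "T \<equiv> \<lambda>F. trace (matrix_inv (complement_matrix F))"
    and "\<delta> \<equiv> 2 / (real CARD('v) * (real CARD('v) - 2))"
  shows "T (B \<union> G) \<ge> T B + real (card G) * \<delta> \<and>
    (T (B \<union> G) = T B + real (card G) * \<delta> \<longleftrightarrow> (\<forall>g\<in>G. \<forall>h\<in>B \<union> G - {g}. g \<inter> h = {})) \<and>
    pos_def (complement_matrix B)"
proof -
  have "finite G" by (rule finite)
  then show ?thesis using assms(1-3)
  proof (induction G)
    case empty
    then show ?case by simp
  next
    case (insert e G)
    have eq: "B \<union> insert e G = insert e (B \<union> G)" by simp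
    have e: "e \<notin> B \<union> G" using insert by auto
    have card2: "\<And>g. g \<in> insert e (B \<union> G) \<Longrightarrow> card g = 2" using insert.prems(1) by auto
    have pd: "pos_def (complement_matrix (insert e (B \<union> G)))" using insert.prems(3) by simp
    note step = trace_increment_ge[OF card2 e pd] trace_increment_gt[OF card2 e pd]
      trace_increment_eq[OF card2 e pd]
    have IH: "T (B \<union> G) \<ge> T B + real (card G) * \<delta>"
      "T (B \<union> G) = T B + real (card G) * \<delta> \<longleftrightarrow> (\<forall>g\<in>G. \<forall>h\<in>B \<union> G - {g}. g \<inter> h = {})"
      "pos_def (complement_matrix B)"
      using insert.IH pos_def_complement_matrix_remove[OF card2 e pd] insert.prems by auto
    have card: "real (card (insert e G)) * \<delta> = real (card G) * \<delta> + \<delta>"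
      using insert.hyps by (simp add: algebra_simps)
    have ge: "T (insert e (B \<union> G)) \<ge> T (B \<union> G) + \<delta>"
      using step(1) by (simp add: T_def \<delta>_def)
    have eq': "T (insert e (B \<union> G)) = T (B \<union> G) + \<delta> \<longleftrightarrow> (\<forall>g\<in>B \<union> G. e \<inter> g = {})"
    proof
      assume "T (insert e (B \<union> G)) = T (B \<union> G) + \<delta>"
      then show "\<forall>g\<in>B \<union> G. e \<inter> g = {}"
        using step(2) unfolding T_def \<delta>_def by (metis less_irrefl)
    next
      assume "\<forall>g\<in>B \<union> G. e \<inter> g = {}"
      then show "T (insert e (B \<union> G)) = T (B \<union> G) + \<delta>"
        using step(3) by (simp add: T_def \<delta>_def)
    qed
    \<comment> \<open>Two lower bounds are added, so the sum is tight exactly if both are.\<close>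
    have "T (insert e (B \<union> G)) = T B + real (card (insert e G)) * \<delta> \<longleftrightarrow>
        T (B \<union> G) = T B + real (card G) * \<delta> \<and> T (insert e (B \<union> G)) = T (B \<union> G) + \<delta>"
      using ge IH(1) unfolding card by linarith
    also have "\<dots> \<longleftrightarrow> (\<forall>g\<in>insert e G. \<forall>h\<in>B \<union> insert e G - {g}. g \<inter> h = {})"
      unfolding IH(2) eq' using e by (auto simp: Int_commute) blast+
    finally show ?case unfolding eq using ge IH(1,3) card by simp
  qed
qed

text \<open>Gives positive definiteness from the shape alone, as required for \<open>F0\<close>: the
  components of the deletion graph are vertex-disjoint with Laplacian eigenvalues at most 3, which
  is below \<open>CARD('v)\<close>.\<close>

lemma pos_def_of_P3_and_matching:
  fixes F :: "'v::finite set set"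
  assumes card2: "\<And>g. g \<in> F \<Longrightarrow> card g = 2" and P: "P3_and_matching F" and n4: "CARD('v) \<ge> 4"
  shows "pos_def (complement_matrix F)"
  unfolding pos_def_def
proof (intro allI impI)
  fix z :: "real^'v" assume z: "z \<noteq> 0"
  obtain e f where ef: "e \<in> F" "f \<in> F" "e \<noteq> f" "e \<inter> f \<noteq> {}"
    and disj: "\<forall>g\<in>F - {e, f}. \<forall>h\<in>F - {g}. g \<inter> h = {}"
    using P unfolding P3_and_matching_def by (elim bexE conjE)
  define G where "G = F - {e, f}"
  define q where "q g = z \<bullet> (edge_laplacian g *v z)" for g
  define s where "s = (\<lambda>i. (z $ i)\<^sup>2)"
  have q2: "q g \<le> 3 * sum s g" if g: "g \<in> G" for g
  proof -
    obtain u v where uv: "u \<noteq> v" "g = {u, v}" using card2[of g] g card_2_iff unfolding G_def by (metis DiffD1)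
    then have "q g = (z $ u - z $ v)\<^sup>2" by (simp add: q_def inner_edge_laplacian_doubleton)
    \<comment> \<open>A single edge would allow the constant 2; the added squares reach 3 to match
      the path.\<close>
    also have "\<dots> \<le> (z $ u - z $ v)\<^sup>2 + ((z $ u + z $ v)\<^sup>2 + (z $ u)\<^sup>2 + (z $ v)\<^sup>2)"
      by simp
    also have "\<dots> = 3 * (s u + s v)"
      by (simp add: s_def power2_eq_square algebra_simps)
    finally show ?thesis using uv by simp
  qed
  have path: "q e + q f \<le> 3 * sum s (e \<union> f)"
  proof -
    obtain x y w where xw: "e = {x, y}" "f = {y, w}" "x \<noteq> y" "y \<noteq> w" "x \<noteq> w"
      using card2[OF ef(1)] card2[OF ef(2)] ef(3,4) by (rule edge_pairE)
    have "e \<union> f = {x, y, w}" using xw by auto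
    then have "sum s (e \<union> f) = s x + s y + s w" using xw by simp
    moreover have "q e + q f = (z $ x - z $ y)\<^sup>2 + (z $ y - z $ w)\<^sup>2"
      using xw by (simp add: q_def inner_edge_laplacian_doubleton)
    \<comment> \<open>The added squares are exactly what the path form lacks to three times the
      squared norm; 3 is its largest eigenvalue.\<close>
    moreover have "\<dots> \<le> (z $ x - z $ y)\<^sup>2 + (z $ y - z $ w)\<^sup>2
        + ((z $ x + z $ y + z $ w)\<^sup>2 + (z $ x - z $ w)\<^sup>2)"
      by simp
    moreover have "\<dots> = 3 * (s x + s y + s w)"
      by (simp add: s_def power2_eq_square algebra_simps)
    ultimately show ?thesis by simp
  qed
  have "sum q F = q e + (q f + sum q (F - {e} - {f}))"
    using ef sum.remove[of F e q] sum.remove[of "F - {e}" f q] by simp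
  also have "\<dots> = q e + q f + sum q G"
    by (simp add: G_def Diff_insert2[of F e "{f}"])
  also have "\<dots> \<le> 3 * sum s (e \<union> f) + (\<Sum>g\<in>G. 3 * sum s g)"
    using path q2 by (intro add_mono sum_mono)
  also have "(\<Sum>g\<in>G. 3 * sum s g) = 3 * sum s (\<Union>G)"
    using disj by (subst sum.Union_disjoint) (auto simp: G_def sum_distrib_left)
  also have "3 * sum s (e \<union> f) + 3 * sum s (\<Union>G) = 3 * sum s ((e \<union> f) \<union> \<Union>G)"
  proof -
    have "(e \<union> f) \<inter> \<Union>G = {}" using disj ef unfolding G_def by blast
    then show ?thesis by (simp add: sum.union_disjoint)
  qed
  also have "\<dots> \<le> 3 * sum s UNIV"
    by (intro mult_left_mono sum_mono2) (auto simp: s_def)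
  also have "sum s UNIV = z \<bullet> z" by (simp add: s_def inner_vec_def power2_eq_square)
  finally have "sum q F \<le> 3 * (z \<bullet> z)" .
  also have "\<dots> < real CARD('v) * (z \<bullet> z)" using z n4 by simp
  finally show "0 < z \<bullet> (complement_matrix F *v z)" by (simp add: inner_complement_matrix q_def)
qed

text \<open>The meeting pair is the base to which the other edges are added; multiplying the trace
  bound by \<open>n\<close> gives \<open>V\<close>. The equality condition refers to the chosen
  pair.\<close>

lemma kirchhoff_index_path_union:
  fixes F :: "'v::finite set set"
  assumes F: "F \<subseteq> edges (complete_graph UNIV)"
    and ef: "e \<in> F" "f \<in> F" "e \<noteq> f" "e \<inter> f \<noteq> {}"
    and pd: "pos_def (complement_matrix F)" and n4: "CARD('v) \<ge> 4"
  defines "n \<equiv> real CARD('v)"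
  defines "V \<equiv> n - 1 + 3 / (n - 3) + 1 / (n - 1) + 2 * (real (card F) - 2) / (n - 2)"
  shows "kirchhoff_index (delete_edges (complete_graph UNIV) F) \<ge> V"
    and "kirchhoff_index (delete_edges (complete_graph UNIV) F) = V \<longleftrightarrow>
      (\<forall>g\<in>F - {e, f}. \<forall>h\<in>F - {g}. g \<inter> h = {})"
proof -
  define G where "G = F - {e, f}"
  define T where "T F = trace (matrix_inv (complement_matrix (F :: 'v set set)))" for F
  define \<delta> where "\<delta> = 2 / (n * (n - 2))"
  have n: "n \<ge> 4" using n4 by (simp add: n_def)
  have FG: "{e, f} \<union> G = F" using ef by (auto simp: G_def)
  have card2: "\<And>g. g \<in> F \<Longrightarrow> card g = 2" using card_edge[OF F] .
  have "card G = card F - 2" using ef by (simp add: G_def card_Diff_subset)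
  moreover have "2 \<le> card F" using card_mono[of F "{e, f}"] ef by simp
  ultimately have cG: "real (card G) = real (card F) - 2" by simp
  have *: "T F \<ge> T {e, f} + real (card G) * \<delta>"
    "T F = T {e, f} + real (card G) * \<delta> \<longleftrightarrow> (\<forall>g\<in>G. \<forall>h\<in>F - {g}. g \<inter> h = {})"
    "pos_def (complement_matrix {e, f})"
    using trace_inv_union[of "{e, f}" G] card2 pd unfolding FG
    by (auto simp: T_def \<delta>_def n_def G_def)
  have "T {e, f} = 1 + 3 / (n * (n - 3)) + 1 / (n * (n - 1))"
    unfolding T_def n_def using *(3) ef card2 n4 by (intro trace_inv_path) auto
  then have V: "V = n * (T {e, f} + real (card G) * \<delta>) - 1"
    using n by (simp add: V_def \<delta>_def cG distrib_left)
  have Kf: "kirchhoff_index (delete_edges (complete_graph UNIV) F) = n * T F - 1"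
    using kirchhoff_index_eq_trace[OF F pd] by (simp add: n_def T_def)
  show "kirchhoff_index (delete_edges (complete_graph UNIV) F) \<ge> V"
    unfolding V Kf using *(1) n by simp
  show "kirchhoff_index (delete_edges (complete_graph UNIV) F) = V \<longleftrightarrow>
      (\<forall>g\<in>F - {e, f}. \<forall>h\<in>F - {g}. g \<inter> h = {})"
    unfolding V Kf using *(2) n by (simp add: G_def)
qed

theorem theorem6p2:
  fixes n p :: nat
    and K :: "'v::finite sgraph"
    and F F0 :: "'v set set"
  assumes n_def: "n = CARD('v)"
    and K_def: "K = complete_graph (UNIV :: 'v set)"
    and p_ge: "p \<ge> 2"
    and n_ge: "n \<ge> max 4 (2 * p - 1)"
    and F_edges: "F \<subseteq> edges K"
    and F_card: "card F = p"
    and conn: "graph_connected (delete_edges K F)"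
    and F0_edges: "F0 \<subseteq> edges K"
    and F0_iso: "graph_iso (deletion_graph F0) (P3_plus_edges p)"
    and not_matching: "\<not> is_matching (deletion_graph F)"
  shows "kirchhoff_index (delete_edges K F) \<ge> kirchhoff_index (delete_edges K F0)
    \<and> kirchhoff_index (delete_edges K F) \<ge>
        real n - 1 + 3 / (real n - 3) + 1 / (real n - 1) + 2 * (real p - 2) / (real n - 2)
    \<and> (kirchhoff_index (delete_edges K F) = kirchhoff_index (delete_edges K F0)
         \<longleftrightarrow> graph_iso (deletion_graph F) (P3_plus_edges p))
    \<and> (kirchhoff_index (delete_edges K F) =
           real n - 1 + 3 / (real n - 3) + 1 / (real n - 1) + 2 * (real p - 2) / (real n - 2)
         \<longleftrightarrow> graph_iso (deletion_graph F) (P3_plus_edges p))"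
proof -
  let ?V = "real n - 1 + 3 / (real n - 3) + 1 / (real n - 1) + 2 * (real p - 2) / (real n - 2)"
  let ?Kf = "\<lambda>F. kirchhoff_index (delete_edges K F)"
  have n4: "CARD('v) \<ge> 4" using n_ge n_def by simp
  have F: "F \<subseteq> edges (complete_graph UNIV)" and F0: "F0 \<subseteq> edges (complete_graph UNIV)"
    using F_edges F0_edges K_def by auto
  \<comment> \<open>Used for \<open>F0\<close> to compute its index, and for \<open>F\<close> in one
    direction of the equality case.\<close>
  have extremal: "?Kf H = ?V"
    if H: "H \<subseteq> edges (complete_graph UNIV)" and P: "P3_and_matching H" and c: "card H = p" for H
  proof -
    obtain e f where ef: "e \<in> H" "f \<in> H" "e \<noteq> f" "e \<inter> f \<noteq> {}"
      and disj: "\<forall>g\<in>H - {e, f}. \<forall>h\<in>H - {g}. g \<inter> h = {}"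
      using P unfolding P3_and_matching_def by (elim bexE conjE)
    have "pos_def (complement_matrix H)"
      using pos_def_of_P3_and_matching card_edge[OF H] P n4 by blast
    then show ?thesis
      using kirchhoff_index_path_union(2)[OF H ef _ n4] disj by (simp add: K_def n_def c)
  qed
  have iso: "graph_iso (deletion_graph F) (P3_plus_edges p) \<longleftrightarrow> P3_and_matching F"
    using graph_iso_P3_plus_edges_iff[OF card_edge[OF F] p_ge] F_card by simp
  have "P3_and_matching F0 \<and> card F0 = p"
    using graph_iso_P3_plus_edges_iff[OF card_edge[OF F0] p_ge] F0_iso by simp
  then have V0: "?Kf F0 = ?V" using extremal[OF F0] by simp
  \<comment> \<open>Failure of the matching property supplies the base pair.\<close>
  obtain e f where ef: "e \<in> F" "f \<in> F" "e \<noteq> f" "e \<inter> f \<noteq> {}"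
    using not_matching by (auto simp: is_matching_def deletion_graph_def)
  have pd: "pos_def (complement_matrix F)"
    using pos_def_of_connected[OF F] conn K_def by simp
  have ge: "?Kf F \<ge> ?V"
    using kirchhoff_index_path_union(1)[OF F ef pd n4] by (simp add: K_def n_def F_card)
  have "P3_and_matching F" if "?Kf F = ?V"
  proof -
    have "\<forall>g\<in>F - {e, f}. \<forall>h\<in>F - {g}. g \<inter> h = {}"
      using kirchhoff_index_path_union(2)[OF F ef pd n4] that by (simp add: K_def n_def F_card)
    then show ?thesis unfolding P3_and_matching_def
      by (intro bexI[of _ e] bexI[of _ f] conjI ef)
  qed
  then have "?Kf F = ?V \<longleftrightarrow> P3_and_matching F" using extremal[OF F _ F_card] by blast
  then show ?thesis unfolding iso V0 using ge by simp
qed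

end
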